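(* Let $p>3$ be a prime and let $$T(p)=\sum_{\substack{1\le u,a,b\le p-1\\ (a-1)^2(u\overline{a}-1)(ub-1)\equiv (b-1)^2(u\overline{b}-1)(ua-1) \pmod p}} \chi_0\big((a-1)^2(u\overline{a}-1)(ub-1)\big).$$ Then $$T(p)=(p-5)(2p-5)-\left(\frac{2}{p}\right)+\sum_{\substack{1\le a,b\le p-1\\ a\not\equiv b \pmod p\\ a+b-2ab\not\equiv 0 \pmod p}}\left(\frac{\Delta(a,b)}{p}\right),$$ where $\Delta(a,b)=\left(1-a^2b^2\right)^2+4ab(a+b-2)(a+b-2ab)$.
   Context: For an integer $a$ coprime to $p$, $\overline{a}$ denotes an integer with $a\overline{a}\equiv 1 \pmod p$. $\chi_0$ is the principal character mod $p$: $\chi_0(x)=1$ if $p\nmid x$ and $\chi_0(x)=0$ if $p\mid x$. $\left(\frac{\cdot}{p}\right)$ is the Legendre symbol (equal to $0$ at multiples of $p$). *)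

theory Defs
  imports "HOL-Number_Theory.Number_Theory"
begin

definition principal_char :: "int \<Rightarrow> int \<Rightarrow> int" where
  "principal_char p x = (if p dvd x then 0 else 1)"

text \<open>The inverse of \<open>a\<close> modulo \<open>p\<close> is the library's \<open>modular_inverse p a\<close>. Since \<open>a\<close> and \<open>b\<close>
  range over \<open>1, \<dots>, p - 1\<close>, it is a genuine inverse, and it occurs only inside congruences
  and arguments of characters modulo \<open>p\<close>, so the choice of representative is immaterial.\<close>

definition T :: "int \<Rightarrow> int" where
  "T p = (\<Sum>(u, a, b) \<in> {(u, a, b) \<in> {1..p-1} \<times> {1..p-1} \<times> {1..p-1}.
            [(a - 1)^2 * (u * modular_inverse p a - 1) * (u * b - 1)
               = (b - 1)^2 * (u * modular_inverse p b - 1) * (u * a - 1)] (mod p)}.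
          principal_char p ((a - 1)^2 * (u * modular_inverse p a - 1) * (u * b - 1)))"

definition Delta :: "int \<Rightarrow> int \<Rightarrow> int" where
  "Delta a b = (1 - a^2 * b^2)^2 + 4 * a * b * (a + b - 2) * (a + b - 2 * a * b)"

end

theory Submission
  imports Defs
begin

text \<open>
  Multiplied by \<open>ab\<close>, the difference of the two sides of the congruence factors as \<open>(a - b) Q(u)\<close>
  with \<open>Q\<close> quadratic in \<open>u\<close>, of leading coefficient \<open>-(a + b - 2ab)\<close> and discriminant \<open>Delta a b\<close>.
  The diagonal \<open>a = b\<close> contributes \<open>(p - 2) + (p - 3)\<^sup>2\<close>. Off the diagonal, \<open>Q\<close> has
  \<open>1 + Legendre (Delta a b) p\<close> roots, or, when \<open>a + b - 2ab\<close> vanishes, exactly one root unless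
  \<open>ab = -1\<close>, in which case it has none; the latter happens for \<open>1 + Legendre 2 p\<close> pairs, since then
  \<open>(a + 1)\<^sup>2 = 2\<close>. The roots to be discarded are \<open>u = 0\<close> (for \<open>p - 3\<close> pairs) and those at which both
  sides of the congruence vanish (\<open>6p - 14\<close> triples).
\<close>

context
  fixes p :: int
  assumes prime_p: "prime p" and p_gt_3: "p > 3"
begin

section \<open>Divisibility by \<open>p\<close> and residues\<close>

lemma dvd_mult_iff: "p dvd x * y \<longleftrightarrow> p dvd x \<or> p dvd y"
  using prime_p by (rule prime_dvd_mult_iff)

lemma dvd_power2_iff: "p dvd x\<^sup>2 \<longleftrightarrow> p dvd x"
  by (simp add: power2_eq_square dvd_mult_iff)

lemma not_dvd_small: "0 < x \<Longrightarrow> x < p \<Longrightarrow> \<not> p dvd x"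
  by (simp add: zdvd_not_zless)

lemma dvd_diff_residues_iff:
  assumes "x \<in> {0..p-1}" "y \<in> {0..p-1}"
  shows "p dvd x - y \<longleftrightarrow> x = y"
  using assms by (auto simp flip: mod_eq_dvd_iff)

lemma dvd_residue_iff: "x \<in> {0..p-1} \<Longrightarrow> p dvd x \<longleftrightarrow> x = 0"
  using dvd_diff_residues_iff[of x 0] p_gt_3 by simp

lemma dvd_cong_iff: "p dvd x - y \<Longrightarrow> p dvd x \<longleftrightarrow> p dvd y"
  by (metis dvd_diff_commute diff_add_cancel dvd_add_right_iff)

text \<open>Injectivity suffices, since the residues form a finite set mapped into itself. This
  justifies linear substitutions when counting roots.\<close>

lemma bij_betw_affine_residues:
  assumes "\<not> p dvd c"
  shows "bij_betw (\<lambda>x. (c * x + d) mod p) {0..p-1} {0..p-1}"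
proof -
  let ?f = "\<lambda>x. (c * x + d) mod p"
  have "inj_on ?f {0..p-1}"
  proof (rule inj_onI)
    fix x y assume xy: "x \<in> {0..p-1}" "y \<in> {0..p-1}" "?f x = ?f y"
    then have "p dvd (c * x + d) - (c * y + d)"
      by (simp add: mod_eq_dvd_iff)
    then have "p dvd c * (x - y)"
      by (simp add: algebra_simps)
    then show "x = y"
      using assms xy by (simp add: dvd_mult_iff dvd_diff_residues_iff)
  qed
  moreover have "?f ` {0..p-1} \<subseteq> {0..p-1}"
    using p_gt_3 by auto
  ultimately show ?thesis
    by (simp add: bij_betw_def endo_inj_surj)
qed

section \<open>Roots of quadratic and linear congruences\<close>

text \<open>The three values of the Legendre symbol match three cases: only the root 0 if
  \<open>p\<close> divides \<open>D\<close>, a pair of opposite roots for a nonzero square, no root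
  for a nonresidue.\<close>

lemma card_square_roots: "int (card {x \<in> {0..p-1}. p dvd x\<^sup>2 - D}) = 1 + Legendre D p"
proof (cases "p dvd D")
  case True
  then have "{x \<in> {0..p-1}. p dvd x\<^sup>2 - D} = {0}"
    using p_gt_3 by (auto simp: dvd_diff_left_iff dvd_power2_iff dvd_residue_iff)
  with True show ?thesis
    by (simp add: Legendre_def cong_0_iff)
next
  case False
  show ?thesis
  proof (cases "QuadRes p D")
    case True
    then obtain y where y: "p dvd y\<^sup>2 - D"
      by (auto simp: QuadRes_def cong_iff_dvd_diff)
    have ny: "\<not> p dvd y"
      using y False dvd_cong_iff dvd_power2_iff by blast
    have "p dvd x\<^sup>2 - D \<longleftrightarrow> p dvd x - y \<or> p dvd x + y" for x
    proof -
      have "p dvd x\<^sup>2 - D \<longleftrightarrow> p dvd x\<^sup>2 - y\<^sup>2"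
        using y by (intro dvd_cong_iff) simp
      also have "x\<^sup>2 - y\<^sup>2 = (x - y) * (x + y)"
        by (simp add: power2_eq_square algebra_simps)
      finally show ?thesis
        by (simp add: dvd_mult_iff)
    qed
    moreover have "p dvd x - y \<longleftrightarrow> x = y mod p" if "x \<in> {0..p-1}" for x
      using that by (metis atLeastAtMost_iff mod_eq_dvd_iff mod_pos_pos_trivial zle_diff1_eq)
    moreover have "p dvd x + y \<longleftrightarrow> x = (- y) mod p" if "x \<in> {0..p-1}" for x
      using that by (metis atLeastAtMost_iff mod_eq_dvd_iff mod_pos_pos_trivial zle_diff1_eq
          diff_minus_eq_add)
    ultimately have "{x \<in> {0..p-1}. p dvd x\<^sup>2 - D} = {y mod p, (- y) mod p}"
      using p_gt_3 by auto
    \<comment> \<open>The two roots could coincide only if \<open>p\<close> divided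
      \<open>2 * y\<close>, which fails because \<open>p\<close> is odd.\<close>
    moreover have "y mod p \<noteq> (- y) mod p"
      using ny not_dvd_small[of 2] p_gt_3 dvd_mult_iff[of 2 y] by (simp add: mod_eq_dvd_iff)
    ultimately show ?thesis
      using True False by (simp add: Legendre_def cong_0_iff)
  next
    case nonres: False
    then have "{x \<in> {0..p-1}. p dvd x\<^sup>2 - D} = {}"
      by (auto simp: QuadRes_def cong_iff_dvd_diff)
    then have "card {x \<in> {0..p-1}. p dvd x\<^sup>2 - D} = 0"
      by (simp only: card.empty)
    with nonres False show ?thesis
      by (simp add: Legendre_def cong_0_iff)
  qed
qed

text \<open>Completing the square: multiplication by the unit \<open>4 * A\<close> turns the
  congruence into "\<open>2 * A * u + B\<close> is a square root of the discriminant", and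
  \<open>u \<mapsto> 2 * A * u + B\<close> permutes the residues.\<close>

lemma card_quadratic_roots:
  assumes "\<not> p dvd A"
  shows "int (card {u \<in> {0..p-1}. p dvd A * u\<^sup>2 + B * u + C}) = 1 + Legendre (B\<^sup>2 - 4 * A * C) p"
proof -
  have "\<not> p dvd 2" "\<not> p dvd 4"
    using p_gt_3 not_dvd_small[of 2] dvd_mult_iff[of 2 2] by auto
  then have bij: "bij_betw (\<lambda>u. (2 * A * u + B) mod p) {0..p-1} {0..p-1}"
    using assms by (intro bij_betw_affine_residues) (simp add: dvd_mult_iff)
  have "p dvd ((2 * A * u + B) mod p)\<^sup>2 - (B\<^sup>2 - 4 * A * C) \<longleftrightarrow> p dvd A * u\<^sup>2 + B * u + C" for u
  proof -
    have "p dvd ((2 * A * u + B) mod p)\<^sup>2 - (B\<^sup>2 - 4 * A * C) \<longleftrightarrow>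
        p dvd (2 * A * u + B)\<^sup>2 - (B\<^sup>2 - 4 * A * C)"
      by (simp flip: mod_eq_dvd_iff add: power_mod)
    also have "(2 * A * u + B)\<^sup>2 - (B\<^sup>2 - 4 * A * C) = 4 * A * (A * u\<^sup>2 + B * u + C)"
      by (simp add: power2_eq_square algebra_simps)
    finally show ?thesis
      using assms \<open>\<not> p dvd 4\<close> by (simp add: dvd_mult_iff)
  qed
  then have "card {u \<in> {0..p-1}. p dvd A * u\<^sup>2 + B * u + C} =
      card {x \<in> {0..p-1}. p dvd x\<^sup>2 - (B\<^sup>2 - 4 * A * C)}"
    by (intro bij_betw_same_card[OF bij_betw_Collect[OF bij]]) simp
  then show ?thesis
    by (simp only: card_square_roots)
qed

lemma card_linear_roots:
  assumes "\<not> p dvd B"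
  shows "card {u \<in> {0..p-1}. p dvd B * u + C} = 1"
proof -
  have "card {u \<in> {0..p-1}. p dvd B * u + C} = card {x \<in> {0..p-1}. x = 0}"
    by (intro bij_betw_same_card[OF bij_betw_Collect[OF bij_betw_affine_residues[OF assms, of C]]])
       (simp add: dvd_eq_mod_eq_0)
  also have "{x \<in> {0..p-1}. x = 0} = {0}"
    using p_gt_3 by auto
  finally show ?thesis by simp
qed

section \<open>Reducing \<open>T p\<close> to counting solutions \<open>u\<close> for each pair
  \<open>(a, b)\<close>\<close>

definition quad :: "int \<Rightarrow> int \<Rightarrow> int \<Rightarrow> int" where
  "quad a b u = - (a + b - 2 * a * b) * u\<^sup>2 + (1 - a\<^sup>2 * b\<^sup>2) * u + a * b * (a + b - 2)"

text \<open>The left side is \<open>a * b\<close> times the difference of the two sides of the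
  congruence, with each product of a residue and its inverse replaced by 1; thus \<open>u\<close>
  times the inverse of \<open>a\<close>, minus 1, becomes \<open>u - a\<close>.\<close>

lemma difference_eq_quad:
  "b * (a - 1)\<^sup>2 * (u - a) * (u * b - 1) - a * (b - 1)\<^sup>2 * (u - b) * (u * a - 1)
     = (a - b) * quad a b u"
  by (simp add: quad_def power2_eq_square algebra_simps)

definition roots :: "int \<Rightarrow> int \<Rightarrow> int set" where
  "roots a b = {u \<in> {0..p-1}. p dvd quad a b u}"

text \<open>These are the \<open>u\<close> contributing 1 to \<open>T p\<close> for a given pair.
  The character condition is split into its prime-to-\<open>p\<close> factors, and the factor
  \<open>a - b\<close> is kept so that diagonal pairs are covered too.\<close>

definition fibre :: "int \<Rightarrow> int \<Rightarrow> int set" where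
  "fibre a b = {u \<in> {1..p-1}. p dvd (a - b) * quad a b u
     \<and> \<not> p dvd a - 1 \<and> \<not> p dvd u - a \<and> \<not> p dvd u * b - 1}"

lemma finite_fibre [simp]: "finite (fibre a b)"
  by (rule finite_subset[of _ "{1..p-1}"]) (auto simp: fibre_def)

lemma nonzero_residue: "a \<in> {1..p-1} \<Longrightarrow> \<not> p dvd a"
  by (simp add: not_dvd_small)

lemma modular_inverse_dvd:
  assumes "a \<in> {1..p-1}"
  shows "p dvd a * modular_inverse p a - 1"
proof -
  have "coprime p a"
    using nonzero_residue[OF assms] prime_p by (simp add: prime_imp_coprime)
  then show ?thesis
    using cong_modular_inverse1[of a p] by (simp add: coprime_commute cong_iff_dvd_diff)
qed

lemma dvd_inverse_shift_iff:
  assumes "a \<in> {1..p-1}"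
  shows "p dvd u * modular_inverse p a - 1 \<longleftrightarrow> p dvd u - a"
proof -
  have "p dvd u * modular_inverse p a - 1 \<longleftrightarrow> p dvd a * (u * modular_inverse p a - 1)"
    using nonzero_residue[OF assms] by (simp add: dvd_mult_iff)
  also have "a * (u * modular_inverse p a - 1) - (u - a) = u * (a * modular_inverse p a - 1)"
    by (simp add: algebra_simps)
  then have "p dvd a * (u * modular_inverse p a - 1) \<longleftrightarrow> p dvd u - a"
    using modular_inverse_dvd[OF assms] by (intro dvd_cong_iff) simp
  finally show ?thesis .
qed

text \<open>Multiplying by the unit \<open>a * b\<close> changes nothing, and the result differs
  from \<open>(a - b) * quad a b u\<close> only by multiples of \<open>a * a' - 1\<close> and
  \<open>b * b' - 1\<close>, with \<open>a'\<close> and \<open>b'\<close> the inverses.\<close>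

lemma dvd_condition_iff:
  assumes "a \<in> {1..p-1}" "b \<in> {1..p-1}"
  shows "[(a - 1)^2 * (u * modular_inverse p a - 1) * (u * b - 1)
           = (b - 1)^2 * (u * modular_inverse p b - 1) * (u * a - 1)] (mod p)
         \<longleftrightarrow> p dvd (a - b) * quad a b u"
proof -
  define a' b' where "a' = modular_inverse p a" and "b' = modular_inverse p b"
  define X where "X = (a - 1)^2 * (u * a' - 1) * (u * b - 1) - (b - 1)^2 * (u * b' - 1) * (u * a - 1)"
  have "p dvd X \<longleftrightarrow> p dvd a * b * X"
    using assms nonzero_residue by (simp add: dvd_mult_iff)
  also have "a * b * X - (a - b) * quad a b u
      = b * (a - 1)^2 * u * (u * b - 1) * (a * a' - 1) - a * (b - 1)^2 * u * (u * a - 1) * (b * b' - 1)"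
    unfolding difference_eq_quad[symmetric] X_def by (simp add: power2_eq_square algebra_simps)
  then have "p dvd a * b * X \<longleftrightarrow> p dvd (a - b) * quad a b u"
    using assms modular_inverse_dvd unfolding a'_def b'_def
    by (intro dvd_cong_iff) (metis dvd_diff dvd_mult)
  finally show ?thesis
    by (simp add: X_def a'_def b'_def cong_iff_dvd_diff)
qed

lemma T_eq_sum_fibre: "T p = (\<Sum>(a, b) \<in> {1..p-1} \<times> {1..p-1}. int (card (fibre a b)))"
proof -
  let ?R = "{1..p-1}"
  let ?L = "\<lambda>u a b. (a - 1)^2 * (u * modular_inverse p a - 1) * (u * b - 1)"
  let ?C = "\<lambda>u a b. [?L u a b = ?L u b a] (mod p)"
  have "T p = (\<Sum>x \<in> {(u, a, b). u \<in> ?R \<and> a \<in> ?R \<and> b \<in> ?R \<and> ?C u a b \<and> \<not> p dvd ?L u a b}. 1)"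
    unfolding T_def
    by (rule sum.mono_neutral_cong_right)
       (auto simp: principal_char_def intro: finite_subset[of _ "?R \<times> ?R \<times> ?R"])
  also have "\<dots> = (\<Sum>x \<in> (SIGMA ab : ?R \<times> ?R. fibre (fst ab) (snd ab)). 1)"
    by (rule sum.reindex_bij_witness[of _ "\<lambda>((a, b), u). (u, a, b)" "\<lambda>(u, a, b). ((a, b), u)"])
       (auto simp: fibre_def dvd_condition_iff dvd_mult_iff dvd_power2_iff dvd_inverse_shift_iff)
  also have "\<dots> = (\<Sum>ab \<in> ?R \<times> ?R. int (card (fibre (fst ab) (snd ab))))"
    by (simp add: card_SigmaI)
  finally show ?thesis
    by (simp add: case_prod_unfold)
qed

section \<open>Diagonal pairs\<close>

lemma dvd_plus_1_iff: "a \<in> {1..p-1} \<Longrightarrow> p dvd a + 1 \<longleftrightarrow> a = p - 1"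
  using zdvd_imp_le[of p "a + 1"] by auto

lemma dvd_minus_1_iff: "a \<in> {1..p-1} \<Longrightarrow> p dvd a - 1 \<longleftrightarrow> a = 1"
  using dvd_diff_residues_iff[of a 1] p_gt_3 by simp

text \<open>For equal entries the congruence is automatic, so for \<open>a \<noteq> 1\<close> only
  \<open>a\<close> and its inverse are removed from the \<open>p - 1\<close> units. These two
  coincide exactly when \<open>a\<close> squares to 1.\<close>

lemma card_fibre_diagonal:
  assumes a: "a \<in> {1..p-1}"
  shows "int (card (fibre a a)) = (if a = 1 then 0 else if a = p - 1 then p - 2 else p - 3)"
proof (cases "a = 1")
  case True
  then show ?thesis by (simp add: fibre_def)
next
  case False
  define a' where "a' = modular_inverse p a"
  have inv: "p dvd a * a' - 1"
    unfolding a'_def by (rule modular_inverse_dvd[OF a])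
  have "a' \<noteq> 0"
    using inv p_gt_3 by auto
  moreover have "0 \<le> a'" "a' < p"
    unfolding a'_def using p_gt_3 by (simp_all add: modular_inverse_int_nonneg modular_inverse_int_less)
  ultimately have a': "a' \<in> {1..p-1}" by auto
  have "p dvd u * a - 1 \<longleftrightarrow> u = a'" if "u \<in> {1..p-1}" for u
  proof -
    have "u * a - 1 - a * (u - a') = a * a' - 1"
      by (simp add: algebra_simps)
    then have "p dvd u * a - 1 \<longleftrightarrow> p dvd a * (u - a')"
      using inv by (intro dvd_cong_iff) (simp only:)
    then show ?thesis
      using a a' that nonzero_residue[OF a] by (simp add: dvd_mult_iff dvd_diff_residues_iff)
  qed
  then have fib: "fibre a a = {1..p-1} - {a, a'}"
    using a False by (auto simp: fibre_def dvd_minus_1_iff dvd_diff_residues_iff)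
  have "a = a' \<longleftrightarrow> p dvd a * (a - a')"
    using a a' nonzero_residue[OF a] by (simp add: dvd_mult_iff dvd_diff_residues_iff)
  \<comment> \<open>Since \<open>a * a'\<close> is 1 modulo \<open>p\<close>,
    \<open>a * (a - a')\<close> is congruent to the square of \<open>a\<close> minus 1; the factor
    \<open>a - 1\<close> is already excluded.\<close>
  also have "(a - 1) * (a + 1) - a * (a - a') = a * a' - 1"
    by (simp add: algebra_simps)
  then have "p dvd a * (a - a') \<longleftrightarrow> p dvd (a - 1) * (a + 1)"
    using inv by (intro dvd_cong_iff[symmetric]) (simp only:)
  also have "\<dots> \<longleftrightarrow> a = p - 1"
    using a False by (simp add: dvd_mult_iff dvd_minus_1_iff dvd_plus_1_iff)
  finally have eq: "a = a' \<longleftrightarrow> a = p - 1" .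
  have "card (fibre a a) = card {1..p-1} - card {a, a'}"
    unfolding fib using a a' by (intro card_Diff_subset) auto
  then show ?thesis
    using eq False p_gt_3 by (cases "a = a'") (auto simp: card_insert_if)
qed

section \<open>Off-diagonal pairs: from roots to solutions\<close>

text \<open>The number of roots of \<open>quad a b\<close> at which both sides of the congruence vanish, for \<open>a \<noteq> b\<close>.\<close>

definition excess :: "int \<Rightarrow> int \<Rightarrow> int" where
  "excess a b = (if a = 1 \<or> b = 1 then 2 else if a = p - 1 \<or> b = p - 1 then 1 else 0)"

lemma dvd_square_minus_1_iff: "a \<in> {1..p-1} \<Longrightarrow> p dvd a * a - 1 \<longleftrightarrow> a = 1 \<or> a = p - 1"
  using dvd_mult_iff[of "a - 1" "a + 1"] dvd_plus_1_iff[of a] dvd_minus_1_iff[of a]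
  by (simp add: algebra_simps)

text \<open>At a root of \<open>quad\<close> one side of the congruence vanishes iff the other does,
  so both must vanish. Distinct \<open>a\<close>, \<open>b\<close> cannot share the inverse
  \<open>u\<close>. This leaves \<open>u = 1\<close> and the other entry if one entry is 1;
  otherwise \<open>u\<close> is an entry that is its own inverse, namely
  \<open>p - 1\<close>.\<close>

lemma exceptional_roots:
  assumes a: "a \<in> {1..p-1}" and b: "b \<in> {1..p-1}" and ab: "a \<noteq> b"
  shows "int (card {u \<in> {1..p-1}. p dvd quad a b u \<and> (p dvd a - 1 \<or> p dvd u - a \<or> p dvd u * b - 1)})
    = excess a b" (is "int (card ?E) = _")
proof -
  have nab: "\<not> p dvd a - b"
    using a b ab by (simp add: dvd_diff_residues_iff)
  have E: "u \<in> ?E \<longleftrightarrow> (a = 1 \<or> u = a \<or> p dvd u * b - 1) \<and> (b = 1 \<or> u = b \<or> p dvd u * a - 1)"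
    if u: "u \<in> {1..p-1}" for u
  proof -
    let ?L = "b * (a - 1)\<^sup>2 * (u - a) * (u * b - 1)" and ?R = "a * (b - 1)\<^sup>2 * (u - b) * (u * a - 1)"
    have L: "p dvd ?L \<longleftrightarrow> a = 1 \<or> u = a \<or> p dvd u * b - 1"
      using a b u by (simp add: dvd_mult_iff dvd_power2_iff nonzero_residue dvd_minus_1_iff dvd_diff_residues_iff)
    have R: "p dvd ?R \<longleftrightarrow> b = 1 \<or> u = b \<or> p dvd u * a - 1"
      using a b u by (simp add: dvd_mult_iff dvd_power2_iff nonzero_residue dvd_minus_1_iff dvd_diff_residues_iff)
    have "p dvd quad a b u \<longleftrightarrow> p dvd ?L - ?R"
      using nab unfolding difference_eq_quad by (simp add: dvd_mult_iff)
    moreover have "p dvd ?L \<Longrightarrow> p dvd ?L - ?R \<longleftrightarrow> p dvd ?R"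
      by (rule dvd_diff_right_iff)
    ultimately show ?thesis
      using L R a u by (auto simp: dvd_minus_1_iff dvd_diff_residues_iff)
  qed
  have both: "\<not> (p dvd u * a - 1 \<and> p dvd u * b - 1)" if u: "u \<in> {1..p-1}" for u
  proof
    assume "p dvd u * a - 1 \<and> p dvd u * b - 1"
    then have "p dvd (u * a - 1) - (u * b - 1)"
      by (blast intro: dvd_diff)
    then have "p dvd u * (a - b)"
      by (simp add: algebra_simps)
    then show False
      using nab nonzero_residue[OF u] by (simp add: dvd_mult_iff)
  qed
  have "?E = (if a = 1 then {1, b} else if b = 1 then {1, a}
      else if a = p - 1 \<or> b = p - 1 then {p - 1} else {})" (is "_ = ?S")
  proof (rule Set.set_eqI)
    fix u
    show "u \<in> ?E \<longleftrightarrow> u \<in> ?S"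
    proof (cases "u \<in> {1..p-1}")
      case True
      then show ?thesis
        unfolding E[OF True] using a b ab both[OF True]
        by (auto simp: dvd_minus_1_iff dvd_square_minus_1_iff)
    next
      case False
      then show ?thesis using a b by auto
    qed
  qed
  then have "card ?E = card ?S"
    by (simp only:)
  then show ?thesis
    unfolding excess_def using a b ab p_gt_3 by simp
qed

lemma card_fibre_off_diagonal:
  assumes a: "a \<in> {1..p-1}" and b: "b \<in> {1..p-1}" and ab: "a \<noteq> b"
  shows "int (card (fibre a b)) = int (card (roots a b)) - of_bool (p dvd a + b - 2) - excess a b"
proof -
  let ?E = "{u \<in> {1..p-1}. p dvd quad a b u \<and> (p dvd a - 1 \<or> p dvd u - a \<or> p dvd u * b - 1)}"
  \<comment> \<open>This set is \<open>{0}\<close> or empty. It records the possible root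
    \<open>u = 0\<close>, where \<open>quad\<close> takes the value
    \<open>a * b * (a + b - 2)\<close>.\<close>
  let ?Z = "{u \<in> {0 :: int}. p dvd a + b - 2}"
  have nab: "\<not> p dvd a - b"
    using a b ab by (simp add: dvd_diff_residues_iff)
  have split: "{0..p-1} = insert 0 {1..p-1}"
    using p_gt_3 by auto
  have zero: "p dvd quad a b 0 \<longleftrightarrow> p dvd a + b - 2"
    using nonzero_residue[OF a] nonzero_residue[OF b] by (simp add: quad_def dvd_mult_iff)
  have "roots a b = ?Z \<union> (?E \<union> fibre a b)"
    unfolding roots_def fibre_def split using zero nab by (auto simp: dvd_mult_iff)
  then have "card (roots a b) = card (?Z \<union> (?E \<union> fibre a b))"
    by (simp only:)
  also have "\<dots> = card ?Z + (card ?E + card (fibre a b))"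
  proof -
    have "finite ?Z" "finite ?E"
      by (auto intro: finite_subset[of _ "{1..p-1}"])
    moreover have "?Z \<inter> (?E \<union> fibre a b) = {}" "?E \<inter> fibre a b = {}"
      by (auto simp: fibre_def)
    ultimately show ?thesis
      by (simp only: card_Un_disjoint finite_Un finite_fibre simp_thms)
  qed
  finally have "int (card (roots a b)) = int (card ?Z) + (int (card ?E) + int (card (fibre a b)))"
    by (simp only: of_nat_add)
  moreover have "int (card ?Z) = of_bool (p dvd a + b - 2)"
    by auto
  ultimately show ?thesis
    unfolding exceptional_roots[OF a b ab] by linarith
qed

section \<open>Sums of the correction terms over off-diagonal pairs\<close>

definition off_diagonal :: "(int \<times> int) set" where
  "off_diagonal = (SIGMA a : {1..p-1}. {1..p-1} - {a})"

lemma finite_off_diagonal [simp]: "finite off_diagonal"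
  by (simp add: off_diagonal_def)

lemma sum_off_diagonal: "(\<Sum>(a, b) \<in> off_diagonal. f a b) = (\<Sum>a \<in> {1..p-1}. \<Sum>b \<in> {1..p-1} - {a}. f a b)"
  unfolding off_diagonal_def by (rule sum.Sigma[symmetric]) auto

lemma card_off_diagonal: "int (card off_diagonal) = (p - 1) * (p - 2)"
  using p_gt_3 unfolding off_diagonal_def by (simp add: card_Diff_subset)

text \<open>The diagonal counts and the rows of \<open>excess\<close> single out only the
  self-inverse residues 1 and \<open>p - 1\<close>; hence this shape.\<close>

lemma sum_two_exceptions:
  fixes f :: "int \<Rightarrow> int"
  assumes "\<And>a. a \<in> {1..p-1} \<Longrightarrow> f a = (if a = 1 then x else if a = p - 1 then y else z)"
  shows "(\<Sum>a \<in> {1..p-1}. f a) = x + y + (p - 3) * z"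
proof -
  have split: "{1..p-1} = insert 1 (insert (p - 1) {2..p-2})"
    using p_gt_3 by auto
  have "sum f {2..p-2} = (\<Sum>a \<in> {2..p-2}. z)"
    using assms by (intro sum.cong) auto
  then show ?thesis
    using assms[of 1] assms[of "p - 1"] p_gt_3 unfolding split by simp
qed

lemma sum_excess: "(\<Sum>(a, b) \<in> off_diagonal. excess a b) = 6 * p - 14"
proof -
  have "(\<Sum>b \<in> {1..p-1} - {a}. excess a b) =
      (if a = 1 then 2 * (p - 2) else if a = p - 1 then p - 1 else 3)" if a: "a \<in> {1..p-1}" for a
  proof -
    \<comment> \<open>The full row is summed first. The diagonal entry, which is 2, 1 or 0, is then
      subtracted.\<close>
    have "(\<Sum>b \<in> {1..p-1}. excess a b) =
        (if a = 1 then 2 * (p - 1) else if a = p - 1 then p else 3)"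
    proof (subst sum_two_exceptions[where x = 2 and y = "if a = 1 then 2 else 1"
            and z = "if a = 1 then 2 else if a = p - 1 then 1 else 0"])
    qed (use p_gt_3 in \<open>auto simp: excess_def\<close>)
    then show ?thesis
      using a p_gt_3 by (subst sum_diff1) (auto simp: excess_def)
  qed
  then show ?thesis
    unfolding sum_off_diagonal by (subst sum_two_exceptions) auto
qed

text \<open>The only candidate is \<open>b\<close> congruent to \<open>2 - a\<close>. It is on the
  diagonal for \<open>a = 1\<close> and zero for \<open>a = 2\<close>, so \<open>a\<close> runs over
  \<open>{3..p-1}\<close>.\<close>

lemma sum_excluded_zero: "(\<Sum>(a, b) \<in> off_diagonal. of_bool (p dvd a + b - 2)) = p - 3"
proof -
  have iff: "p dvd a + b - 2 \<longleftrightarrow> b = (if a = 1 then 1 else if a = 2 then 0 else p + 2 - a)"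
    if a: "a \<in> {1..p-1}" and b: "b \<in> {1..p-1}" for a b
  proof -
    have "p dvd a + b - 2 \<longleftrightarrow> p dvd b - (if a = 1 then 1 else if a = 2 then 0 else p + 2 - a)"
      using dvd_diff_left_iff[of p p "a + b - 2"] by (auto simp: algebra_simps)
    also have "\<dots> \<longleftrightarrow> b = (if a = 1 then 1 else if a = 2 then 0 else p + 2 - a)"
      using a b p_gt_3 by (intro dvd_diff_residues_iff) auto
    finally show ?thesis .
  qed
  \<comment> \<open>Parity keeps the remaining pairs \<open>(a, p + 2 - a)\<close> off the
    diagonal.\<close>
  have "p + 2 \<noteq> 2 * a" for a
    using prime_odd_int[OF prime_p] p_gt_3 by presburger
  then have "{(a, b) \<in> off_diagonal. p dvd a + b - 2} = (\<lambda>a. (a, p + 2 - a)) ` {3..p-1}"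
    using p_gt_3 by (auto simp: off_diagonal_def iff image_iff split: if_splits)
  then have "card {(a, b) \<in> off_diagonal. p dvd a + b - 2} = card {3..p-1}"
    by (simp add: card_image inj_on_def)
  then show ?thesis
    using p_gt_3 by (simp add: case_prod_unfold sum.If_cases of_bool_def Int_def)
qed

section \<open>Root counts for off-diagonal pairs\<close>

text \<open>Product 1 would force sum 2 modulo \<open>p\<close>, so both entries would be the double
  root 1 of \<open>(c - 1)\<^sup>2\<close>, contradicting \<open>a \<noteq> b\<close>.\<close>

lemma not_dvd_product_minus_1:
  assumes a: "a \<in> {1..p-1}" and b: "b \<in> {1..p-1}" and ab: "a \<noteq> b" and A: "p dvd a + b - 2 * a * b"
  shows "\<not> p dvd a * b - 1"
proof
  assume prod: "p dvd a * b - 1"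
  have "p dvd (a + b - 2 * a * b) + 2 * (a * b - 1)"
    using A prod by (intro dvd_add dvd_mult)
  then have sum: "p dvd a + b - 2"
    by (simp add: algebra_simps)
  have one: "c = 1" if "c \<in> {1..p-1}" "p dvd c + d - 2" "p dvd c * d - 1" for c d
  proof -
    have "p dvd c * (c + d - 2) - (c * d - 1)"
      using that(2,3) by (rule dvd_diff[OF dvd_mult])
    also have "c * (c + d - 2) - (c * d - 1) = (c - 1)\<^sup>2"
      by (simp add: power2_eq_square algebra_simps)
    finally show ?thesis
      using that by (simp add: dvd_power2_iff dvd_minus_1_iff)
  qed
  show False
    using one[OF a sum prod] one[of b a] b sum prod ab by (simp add: ac_simps)
qed

lemma card_roots:
  assumes a: "a \<in> {1..p-1}" and b: "b \<in> {1..p-1}" and ab: "a \<noteq> b"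
  shows "int (card (roots a b)) = 1
    + (if p dvd a + b - 2 * a * b then 0 else Legendre (Delta a b) p)
    - of_bool (p dvd a + b - 2 * a * b \<and> p dvd a * b + 1)"
proof (cases "p dvd a + b - 2 * a * b")
  case False
  then have "\<not> p dvd - (a + b - 2 * a * b)"
    by (subst dvd_minus_iff)
  moreover have "(1 - a\<^sup>2 * b\<^sup>2)\<^sup>2 - 4 * (- (a + b - 2 * a * b)) * (a * b * (a + b - 2)) = Delta a b"
    by (simp add: Delta_def algebra_simps)
  ultimately show ?thesis
    using False card_quadratic_roots[of "- (a + b - 2 * a * b)" "1 - a\<^sup>2 * b\<^sup>2" "a * b * (a + b - 2)"]
    by (simp only: roots_def quad_def if_False simp_thms of_bool_eq)
next
  case True
  note nprod = not_dvd_product_minus_1[OF a b ab True]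
  have "p dvd quad a b u \<longleftrightarrow> p dvd (1 - a\<^sup>2 * b\<^sup>2) * u + a * b * (a + b - 2)" for u
  proof (rule dvd_cong_iff)
    have "p dvd (a + b - 2 * a * b) * (- (u\<^sup>2))"
      using True by (rule dvd_mult2)
    then show "p dvd quad a b u - ((1 - a\<^sup>2 * b\<^sup>2) * u + a * b * (a + b - 2))"
      by (simp add: quad_def algebra_simps)
  qed
  then have roots: "roots a b = {u \<in> {0..p-1}. p dvd (1 - a\<^sup>2 * b\<^sup>2) * u + a * b * (a + b - 2)}"
    by (simp add: roots_def)
  \<comment> \<open>In the degenerate case \<open>quad\<close> is linear. Its coefficient factors,
    and \<open>a * b - 1\<close> has been ruled out, so it vanishes only for product -1.\<close>
  have "1 - a\<^sup>2 * b\<^sup>2 = - ((a * b - 1) * (a * b + 1))"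
    by (simp add: power2_eq_square algebra_simps)
  then have lead: "p dvd 1 - a\<^sup>2 * b\<^sup>2 \<longleftrightarrow> p dvd a * b + 1"
    using nprod by (simp only: dvd_minus_iff dvd_mult_iff simp_thms)
  show ?thesis
  proof (cases "p dvd a * b + 1")
    case False
    then show ?thesis
      using True lead card_linear_roots[of "1 - a\<^sup>2 * b\<^sup>2" "a * b * (a + b - 2)"] by (simp add: roots)
  next
    case prod: True
    \<comment> \<open>With both higher coefficients zero, \<open>quad\<close> is constant. The
      constant is nonzero, since sum 2 would again give product 1.\<close>
    have "\<not> p dvd a + b - 2"
    proof
      assume "p dvd a + b - 2"
      then have "p dvd (a + b - 2) - (a + b - 2 * a * b)"
        using True by (rule dvd_diff)
      also have "(a + b - 2) - (a + b - 2 * a * b) = 2 * (a * b - 1)"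
        by (simp add: algebra_simps)
      finally show False
        using nprod not_dvd_small[of 2] p_gt_3 unfolding dvd_mult_iff by simp
    qed
    then have const: "\<not> p dvd a * b * (a + b - 2)"
      using nonzero_residue[OF a] nonzero_residue[OF b] by (simp add: dvd_mult_iff)
    have "\<not> p dvd (1 - a\<^sup>2 * b\<^sup>2) * u + a * b * (a + b - 2)" for u
      using const prod lead by (simp add: dvd_add_right_iff)
    then have "roots a b = {}"
      by (simp add: roots)
    with True prod show ?thesis by simp
  qed
qed

text \<open>The conditions say that the product is -1 and the sum is -2. With
  \<open>x = a + 1\<close> the pair is \<open>(x - 1, - 1 - x)\<close>, whose product is -1 iff
  \<open>x\<close> is a square root of 2.\<close>

lemma card_rootless_pairs:
  "int (card {(a, b) \<in> off_diagonal. p dvd a + b - 2 * a * b \<and> p dvd a * b + 1}) = 1 + Legendre 2 p"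
  (is "int (card ?M) = _")
proof -
  let ?X = "{x \<in> {0..p-1}. p dvd x\<^sup>2 - 2}"
  let ?f = "\<lambda>x. ((x - 1) mod p, (- 1 - x) mod p)" and ?g = "\<lambda>(a, b). (a + 1) mod p"
  have "bij_betw ?f ?X ?M"
  proof (rule bij_betw_byWitness[where f' = ?g])
    show "\<forall>x \<in> ?X. ?g (?f x) = x"
      by (simp add: mod_simps)
  next
    have "?f (?g (a, b)) = (a, b)"
      if "(a, b) \<in> off_diagonal" "p dvd a + b - 2 * a * b" "p dvd a * b + 1" for a b
    proof -
      \<comment> \<open>The product terms cancel and leave \<open>a + b + 2\<close>, so
        \<open>a\<close> determines \<open>b\<close>.\<close>
      have "p dvd (a + b - 2 * a * b) + 2 * (a * b + 1)"
        using that(2,3) by (rule dvd_add[OF _ dvd_mult])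
      then have "p dvd (- 2 - a) - b"
        by (subst dvd_minus_iff[symmetric]) (simp add: algebra_simps)
      then have "(- 2 - a) mod p = b mod p"
        by (simp add: mod_eq_dvd_iff)
      then show ?thesis
        using that by (simp add: off_diagonal_def mod_simps)
    qed
    then show "\<forall>ab \<in> ?M. ?f (?g ab) = ab"
      by blast
  next
    show "?f ` ?X \<subseteq> ?M"
    proof (rule image_subsetI)
      fix x assume "x \<in> ?X"
      then have x: "p dvd x\<^sup>2 - 2" by simp
      define a b where "a = (x - 1) mod p" and "b = (- 1 - x) mod p"
      have ab: "a \<in> {0..p-1}" "b \<in> {0..p-1}"
        unfolding a_def b_def using p_gt_3 by auto
      have "[a * b + 1 = (x - 1) * (- 1 - x) + 1] (mod p)"
        unfolding a_def b_def by (intro cong_add cong_mult) (simp_all add: cong_def)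
      also have "(x - 1) * (- 1 - x) + 1 = - (x\<^sup>2 - 2)"
        by (simp add: power2_eq_square algebra_simps)
      finally have prod: "p dvd a * b + 1"
        using x by (simp only: cong_dvd_iff dvd_minus_iff)
      have "[a + b + 2 = (x - 1) + (- 1 - x) + 2] (mod p)"
        unfolding a_def b_def by (intro cong_add) (simp_all add: cong_def)
      then have "p dvd a + b + 2"
        by (simp add: cong_0_iff)
      then have "p dvd (a + b + 2) - 2 * (a * b + 1)"
        using prod by (intro dvd_diff dvd_mult)
      then have A: "p dvd a + b - 2 * a * b"
        by (simp add: algebra_simps)
      have "a \<noteq> 0" "b \<noteq> 0"
        using prod p_gt_3 by auto
      moreover have "a \<noteq> b"
      proof
        assume "a = b"
        then have "p dvd (x - 1) - (- 1 - x)"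
          by (simp add: a_def b_def mod_eq_dvd_iff)
        then have "p dvd x"
          using dvd_mult_iff[of 2 x] not_dvd_small[of 2] p_gt_3 by simp
        then have "p dvd 2"
          using x dvd_cong_iff dvd_power2_iff by blast
        then show False
          using not_dvd_small[of 2] p_gt_3 by simp
      qed
      ultimately have "(a, b) \<in> off_diagonal"
        using ab by (auto simp: off_diagonal_def)
      then show "?f x \<in> ?M"
        using prod A by (simp add: a_def b_def)
    qed
  next
    show "?g ` ?M \<subseteq> ?X"
    proof (clarsimp, intro conjI)
      fix a b
      assume "(a, b) \<in> off_diagonal" and A: "p dvd a + b - 2 * a * b" and prod: "p dvd a * b + 1"
      show "0 \<le> (a + 1) mod p" "(a + 1) mod p < p"
        using p_gt_3 by simp_all
      \<comment> \<open>This combination of the two conditions eliminates \<open>b\<close>.\<close>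
      have "p dvd a * (a + b - 2 * a * b) + (2 * a - 1) * (a * b + 1)"
        using A prod by (rule dvd_add[OF dvd_mult dvd_mult])
      also have "a * (a + b - 2 * a * b) + (2 * a - 1) * (a * b + 1) = (a + 1)\<^sup>2 - 2"
        by (simp add: power2_eq_square algebra_simps)
      finally show "p dvd ((a + 1) mod p)\<^sup>2 - 2"
        by (simp add: mod_eq_dvd_iff[symmetric] power_mod)
    qed
  qed
  then have "card ?M = card ?X"
    by (rule bij_betw_same_card[symmetric])
  then show ?thesis
    by (simp only: card_square_roots)
qed

section \<open>Assembling the formula\<close>

lemma sum_card_roots:
  "(\<Sum>(a, b) \<in> off_diagonal. int (card (roots a b))) = (p - 1) * (p - 2)
     + (\<Sum>(a, b) \<in> {(a, b) \<in> off_diagonal. \<not> p dvd a + b - 2 * a * b}. Legendre (Delta a b) p)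
     - (1 + Legendre 2 p)"
proof -
  let ?P = "\<lambda>(a, b). p dvd a + b - 2 * a * b \<and> p dvd a * b + 1"
  let ?N = "\<lambda>(a, b). \<not> p dvd a + b - 2 * a * b"
  let ?l = "\<lambda>(a, b). Legendre (Delta a b) p"
  have "(\<Sum>(a, b) \<in> off_diagonal. int (card (roots a b)))
      = (\<Sum>ab \<in> off_diagonal. 1 + (if ?N ab then ?l ab else 0) - of_bool (?P ab))"
    by (rule sum.cong) (auto simp: off_diagonal_def card_roots)
  also have "\<dots> = int (card off_diagonal) + sum ?l {ab \<in> off_diagonal. ?N ab}
      - int (card {ab \<in> off_diagonal. ?P ab})"
    by (simp add: sum.distrib sum_subtractf sum.inter_filter Int_def)
  finally show ?thesis
    using card_rootless_pairs card_off_diagonal by (simp add: case_prod_unfold)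
qed

lemma T_eq:
  "T p = (p - 5) * (2 * p - 5) - Legendre 2 p
     + (\<Sum>(a, b) \<in> {(a, b) \<in> off_diagonal. \<not> p dvd a + b - 2 * a * b}. Legendre (Delta a b) p)"
proof -
  let ?R = "{1..p-1}"
  have "T p = (\<Sum>a \<in> ?R. \<Sum>b \<in> ?R. int (card (fibre a b)))"
    by (simp add: T_eq_sum_fibre sum.cartesian_product)
  also have "\<dots> = (\<Sum>a \<in> ?R. int (card (fibre a a)) + (\<Sum>b \<in> ?R - {a}. int (card (fibre a b))))"
    by (intro sum.cong refl sum.remove) auto
  also have "\<dots> = (\<Sum>a \<in> ?R. int (card (fibre a a))) + (\<Sum>(a, b) \<in> off_diagonal. int (card (fibre a b)))"
    by (simp add: sum.distrib sum_off_diagonal)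
  also have "(\<Sum>a \<in> ?R. int (card (fibre a a))) = 0 + (p - 2) + (p - 3) * (p - 3)"
    by (rule sum_two_exceptions) (rule card_fibre_diagonal)
  also have "(\<Sum>(a, b) \<in> off_diagonal. int (card (fibre a b)))
      = (\<Sum>(a, b) \<in> off_diagonal. int (card (roots a b)) - of_bool (p dvd a + b - 2) - excess a b)"
    by (rule sum.cong) (auto simp: off_diagonal_def intro!: card_fibre_off_diagonal)
  also have "\<dots> = (\<Sum>(a, b) \<in> off_diagonal. int (card (roots a b))) - (p - 3) - (6 * p - 14)"
    unfolding sum_excluded_zero[symmetric] sum_excess[symmetric]
    by (simp add: case_prod_unfold sum_subtractf)
  \<comment> \<open>The polynomial terms \<open>(p - 2) + (p - 3)\<^sup>2 + (p - 1) * (p - 2) - 1 -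
    (p - 3) - (6 * p - 14)\<close> add up to \<open>(p - 5) * (2 * p - 5)\<close>.\<close>
  finally show ?thesis
    unfolding sum_card_roots by (simp add: algebra_simps)
qed

end

theorem theorem1p3:
  fixes p :: int
  assumes "prime p" and "p > 3"
  shows "T p = (p - 5) * (2 * p - 5) - Legendre 2 p
           + (\<Sum>(a, b) \<in> {(a, b) \<in> {1..p-1} \<times> {1..p-1}.
                \<not> [a = b] (mod p) \<and> \<not> [a + b - 2 * a * b = 0] (mod p)}.
              Legendre (Delta a b) p)"
proof -
  have "{(a, b) \<in> {1..p-1} \<times> {1..p-1}. \<not> [a = b] (mod p) \<and> \<not> [a + b - 2 * a * b = 0] (mod p)}
      = {(a, b) \<in> off_diagonal p. \<not> p dvd a + b - 2 * a * b}"
    by (auto simp: off_diagonal_def[OF assms] cong_def dvd_eq_mod_eq_0)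
  then show ?thesis
    using T_eq[OF assms] by simp
qed

end
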